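(* The realization functor $\mathbb{T}:\mathcal{P}_\Sigma=\square_S^{op}\mathrm{Set}\downarrow\,!^S\Sigma\to\mathrm{CTS}$ from labelled symmetric precubical sets to cubical transition systems is not a left Quillen functor.
   Context: Fix a nonempty set $\Sigma$ of labels. Cubical transition systems. A weak HDTS is a triple $(S,\mu:L\to\Sigma,T=\bigcup_{n\ge1}T_n)$ with $S$ a set (states), $L$ a set (actions), $\mu$ a set map (labelling map), $T_n\subset S\times L^n\times S$ ($n$-transitions), such that: (Multiset axiom) if $(\alpha,u_1,\dots,u_n,\beta)$ is a transition with $n\ge2$, so is $(\alpha,u_{\sigma(1)},\dots,u_{\sigma(n)},\beta)$ for every permutation $\sigma$; (Composition axiom) for $n\ge3$, $p,q\ge1$, $p+q<n$, if $(\alpha,u_1,\dots,u_n,\beta)$, $(\alpha,u_1,\dots,u_p,\nu_1)$, $(\nu_1,u_{p+1},\dots,u_n,\beta)$, $(\alpha,u_1,\dots,u_{p+q},\nu_2)$, $(\nu_2,u_{p+q+1},\dots,u_n,\beta)$ are transitions, so is $(\nu_1,u_{p+1},\dots,u_{p+q},\nu_2)$. A map consists of a set map on states and a label-preserving set map on actions sending transitions to transitions; the category is $\mathrm{WHDTS}$. The $n$-cube $C_n[x_1,\dots,x_n]$ has states $\{0,1\}^n$, actions $(x_1,1),\dots,(x_n,n)$ with $\mu(x_i,i)=x_i$, and $d$-transitions all $(\epsilon,(x_{i_1},i_1),\dots,(x_{i_d},i_d),\epsilon')$ with $i_1,\dots,i_d$ pairwise distinct, $\epsilon_i\le\epsilon'_i$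 for all $i$, and $\epsilon_i\ne\epsilon'_i$ iff $i\in\{i_1,\dots,i_d\}$. $\partial C_n[x_1,\dots,x_n]$ is obtained by removing all $n$-transitions. $\uparrow\! x\!\uparrow$ has states $\{1,2,3,4\}$, one action $x$ (labelled $x$), transitions $(1,x,2)$, $(3,x,4)$. A set is viewed as a weak HDTS with no actions and no transitions. A weak HDTS is a cubical transition system if it is the union of the images of its cubes $C_n[x_1,\dots,x_n]\to X$; $\mathrm{CTS}$ is the full subcategory of these. Labelled symmetric precubical sets. $[n]=\{0,1\}^n$; $\square_S\subset\mathrm{Set}$ is generated by the maps $\delta_i^\alpha:[n-1]\to[n]$ inserting $\alpha\in\{0,1\}$ at position $i$ and the maps $\sigma_i:[n]\to[n]$ swapping coordinates $i,i+1$. Symmetric precubical sets are presheaves on $\square_S$, $K_n=K([n])$. $\square_S[n]$ is the representable presheaf, $\partial\square_S[n]$ agrees with it in degrees $<n$ and is empty in degrees $\ge n$. $(!^SA)_n=A^n$, with faces deleting letters and symmetries exchanging adjacent letters. $\mathcal P_\Sigma$ is the slice category over $!^S\Sigma$. $\square_S[a_1,\dots,a_n]$ is $\square_S[n]\to\,!^S\Sigma$ corresponding to $(a_1,\dots,a_n)$; $\partial\square_S[a_1,\dots,a_n]$ its restriction to the boundary. Sets are coproducts of $\square_S[0]$. Realization. $\mathbb T$ is the unique colimit-preserving functor (a left adjoint) with $\mathbb T(\square_S[a_1,\dots,a_n])=C_n[a_1,\dots,a_n]$ and such that for every map $f$ of labelled cubes, $\mathbb T(f)$ is the unique map of weak HDTS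 equal on states to the map induced by $f$ on $0$-cubes. It takes values in $\mathrm{CTS}$. Model structures. The cofibrations of $\mathrm{CTS}$ are the maps injective on actions; those of $\mathcal P_\Sigma$ are the maps $f$ with $f_n:K_n\to L_n$ injective for all $n\ge1$. For an object $V$ with maps $\gamma^0,\gamma^1:\mathbf 1\to V$ one has $\gamma^k_X:X\to V\times X$, $\gamma=\gamma^0\sqcup\gamma^1$, and for $f:X\to Y$ the canonical maps $f\star\gamma^k:Y\sqcup_X(V\times X)\to V\times Y$ and $f\star\gamma:(Y\sqcup Y)\sqcup_{X\sqcup X}(V\times X)\to V\times Y$; $\Lambda^0=(I\star\gamma^0)\cup(I\star\gamma^1)$, $\Lambda^{n+1}=\Lambda^n\star\gamma$, $\Lambda(V,\varnothing,I)=\bigcup_n\Lambda^n$. $\mathrm{CTS}$ carries the unique combinatorial model structure whose cofibrations are the maps injective on actions and with fibrant objects the $\Lambda_{\mathrm{CTS}}(V,\varnothing,I)$-injective objects, where $V$ has one state $0$, actions $\Sigma\times\{0,1\}$ labelled by projection and all tuples as transitions, $\gamma^k$ is induced by $\Sigma\cong\Sigma\times\{k\}$ (the terminal object having one state, action set $\Sigma$ labelled by the identity, and all tuples as transitions), and $I=\{\varnothing\to\{0\},\{0,1\}\to\{0\}\}\cup\{\partial C_n[x_1,\dots,x_n]\to C_n[x_1,\dots,x_n]\mid n\ge1\}\cup\{C_1[x]\to\uparrow\! x\!\uparrow\}$. $\mathcal P_\Sigma$ carries the unique combinatorial model structure whose cofibrations are the maps $f$ with $f_n:K_n\to L_n$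 injective for all $n\ge1$ and with fibrant objects the $\Lambda_{\mathcal P_\Sigma}(V_{\mathcal P},\varnothing,I_{\mathcal P})$-injective objects, where $V_{\mathcal P}=(!^S(\Sigma\times\{0,1\})\to\,!^S\Sigma)$ with $\gamma^k$ induced by $\Sigma\cong\Sigma\times\{k\}$ and $I_{\mathcal P}=\{\partial\square_S[a_1,\dots,a_n]\subset\square_S[a_1,\dots,a_n]\mid n\ge1\}\cup\{\varnothing\to\{0\},\{0,1\}\to\{0\}\}$. *)

theory Defs
  imports
    "HOL-Library.FuncSet"
    "HOL-Library.Equipollence"
    "HOL-Combinatorics.Permutations"
begin

section \<open>Categories\<close>

text \<open>
  Objects and arrows are restricted to carriers.  \<open>Comp C g f\<close> is "first \<open>f\<close>, then \<open>g\<close>"; it is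
  meaningful only if \<open>Cod C f = Dom C g\<close>.
\<close>

record ('o, 'a) cat =
  Obj :: "'o set"
  Arr :: "'a set"
  Dom :: "'a \<Rightarrow> 'o"
  Cod :: "'a \<Rightarrow> 'o"
  Ident :: "'o \<Rightarrow> 'a"
  Comp :: "'a \<Rightarrow> 'a \<Rightarrow> 'a"

definition hom_set :: "('o, 'a) cat \<Rightarrow> 'o \<Rightarrow> 'o \<Rightarrow> 'a set" where
  "hom_set C x y = {f \<in> Arr C. Dom C f = x \<and> Cod C f = y}"

definition category :: "('o, 'a) cat \<Rightarrow> bool" where
  "category C \<longleftrightarrow>
     (\<forall>f\<in>Arr C. Dom C f \<in> Obj C \<and> Cod C f \<in> Obj C) \<and>
     (\<forall>x\<in>Obj C. Ident C x \<in> hom_set C x x) \<and>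
     (\<forall>f\<in>Arr C. \<forall>g\<in>Arr C. Dom C g = Cod C f \<longrightarrow> Comp C g f \<in> hom_set C (Dom C f) (Cod C g)) \<and>
     (\<forall>f\<in>Arr C. Comp C f (Ident C (Dom C f)) = f \<and> Comp C (Ident C (Cod C f)) f = f) \<and>
     (\<forall>f\<in>Arr C. \<forall>g\<in>Arr C. \<forall>h\<in>Arr C. Dom C g = Cod C f \<longrightarrow> Dom C h = Cod C g \<longrightarrow>
        Comp C h (Comp C g f) = Comp C (Comp C h g) f)"

definition full_subcategory :: "('o, 'a) cat \<Rightarrow> 'o set \<Rightarrow> ('o, 'a) cat" where
  "full_subcategory C S =
     C\<lparr>Obj := Obj C \<inter> S, Arr := {f \<in> Arr C. Dom C f \<in> S \<and> Cod C f \<in> S}\<rparr>"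

text \<open>
  The slice category over an object \<open>b\<close>: objects are the arrows into \<open>b\<close>.
\<close>

record 'a slice_arr =
  sl_dom :: 'a
  sl_arr :: 'a
  sl_cod :: 'a

definition slice :: "('o, 'a) cat \<Rightarrow> 'o \<Rightarrow> ('a, 'a slice_arr) cat" where
  "slice C b =
     \<lparr>Obj = {p \<in> Arr C. Cod C p = b},
      Arr = {t. sl_dom t \<in> Arr C \<and> Cod C (sl_dom t) = b \<and>
                sl_cod t \<in> Arr C \<and> Cod C (sl_cod t) = b \<and>
                sl_arr t \<in> hom_set C (Dom C (sl_dom t)) (Dom C (sl_cod t)) \<and>
                Comp C (sl_cod t) (sl_arr t) = sl_dom t},
      Dom = sl_dom,
      Cod = sl_cod,
      Ident = (\<lambda>p. \<lparr>sl_dom = p, sl_arr = Ident C (Dom C p), sl_cod = p\<rparr>),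
      Comp = (\<lambda>t s. \<lparr>sl_dom = sl_dom s, sl_arr = Comp C (sl_arr t) (sl_arr s), sl_cod = sl_cod t\<rparr>)\<rparr>"

record ('o, 'a, 'p, 'b) fctr =
  fobj :: "'o \<Rightarrow> 'p"
  farr :: "'a \<Rightarrow> 'b"

definition is_functor :: "('o, 'a) cat \<Rightarrow> ('p, 'b) cat \<Rightarrow> ('o, 'a, 'p, 'b) fctr \<Rightarrow> bool" where
  "is_functor C D F \<longleftrightarrow>
     (\<forall>x\<in>Obj C. fobj F x \<in> Obj D) \<and>
     (\<forall>f\<in>Arr C. farr F f \<in> hom_set D (fobj F (Dom C f)) (fobj F (Cod C f))) \<and>
     (\<forall>x\<in>Obj C. farr F (Ident C x) = Ident D (fobj F x)) \<and>
     (\<forall>f\<in>Arr C. \<forall>g\<in>Arr C. Dom C g = Cod C f \<longrightarrow>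
        farr F (Comp C g f) = Comp D (farr F g) (farr F f))"

definition is_terminal :: "('o, 'a) cat \<Rightarrow> 'o \<Rightarrow> bool" where
  "is_terminal C t \<longleftrightarrow> t \<in> Obj C \<and> (\<forall>x\<in>Obj C. \<exists>!f. f \<in> hom_set C x t)"

definition is_product :: "('o, 'a) cat \<Rightarrow> 'o \<Rightarrow> 'o \<Rightarrow> 'o \<Rightarrow> 'a \<Rightarrow> 'a \<Rightarrow> bool" where
  "is_product C x y p pr1 pr2 \<longleftrightarrow>
     pr1 \<in> hom_set C p x \<and> pr2 \<in> hom_set C p y \<and>
     (\<forall>z\<in>Obj C. \<forall>f\<in>hom_set C z x. \<forall>g\<in>hom_set C z y.
        \<exists>!h. h \<in> hom_set C z p \<and> Comp C pr1 h = f \<and> Comp C pr2 h = g)"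

definition is_coproduct :: "('o, 'a) cat \<Rightarrow> 'o \<Rightarrow> 'o \<Rightarrow> 'o \<Rightarrow> 'a \<Rightarrow> 'a \<Rightarrow> bool" where
  "is_coproduct C x y s in1 in2 \<longleftrightarrow>
     in1 \<in> hom_set C x s \<and> in2 \<in> hom_set C y s \<and>
     (\<forall>z\<in>Obj C. \<forall>f\<in>hom_set C x z. \<forall>g\<in>hom_set C y z.
        \<exists>!h. h \<in> hom_set C s z \<and> Comp C h in1 = f \<and> Comp C h in2 = g)"

text \<open>\<open>is_pushout C f g q u v\<close>: \<open>q\<close> with \<open>u\<close>, \<open>v\<close> is a pushout of \<open>f\<close> and \<open>g\<close>, where \<open>u f = v g\<close>.\<close>

definition is_pushout :: "('o, 'a) cat \<Rightarrow> 'a \<Rightarrow> 'a \<Rightarrow> 'o \<Rightarrow> 'a \<Rightarrow> 'a \<Rightarrow> bool" where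
  "is_pushout C f g q u v \<longleftrightarrow>
     f \<in> Arr C \<and> g \<in> Arr C \<and> Dom C f = Dom C g \<and>
     u \<in> hom_set C (Cod C f) q \<and> v \<in> hom_set C (Cod C g) q \<and> Comp C u f = Comp C v g \<and>
     (\<forall>z\<in>Obj C. \<forall>u'\<in>hom_set C (Cod C f) z. \<forall>v'\<in>hom_set C (Cod C g) z.
        Comp C u' f = Comp C v' g \<longrightarrow>
        (\<exists>!h. h \<in> hom_set C q z \<and> Comp C h u = u' \<and> Comp C h v = v'))"

definition is_cocone ::
  "('i, 'j) cat \<Rightarrow> ('o, 'a) cat \<Rightarrow> ('i, 'j, 'o, 'a) fctr \<Rightarrow> 'o \<Rightarrow> ('i \<Rightarrow> 'a) \<Rightarrow> bool" where
  "is_cocone J C D c inc \<longleftrightarrow>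
     c \<in> Obj C \<and>
     (\<forall>j\<in>Obj J. inc j \<in> hom_set C (fobj D j) c) \<and>
     (\<forall>u\<in>Arr J. Comp C (inc (Cod J u)) (farr D u) = inc (Dom J u))"

definition is_colimit ::
  "('i, 'j) cat \<Rightarrow> ('o, 'a) cat \<Rightarrow> ('i, 'j, 'o, 'a) fctr \<Rightarrow> 'o \<Rightarrow> ('i \<Rightarrow> 'a) \<Rightarrow> bool" where
  "is_colimit J C D c inc \<longleftrightarrow>
     is_cocone J C D c inc \<and>
     (\<forall>c' inc'. is_cocone J C D c' inc' \<longrightarrow>
        (\<exists>!h. h \<in> hom_set C c c' \<and> (\<forall>j\<in>Obj J. Comp C h (inc j) = inc' j)))"

text \<open>
  \<open>U\<close> is the universe: a set is small if it has strictly smaller cardinality than \<open>U\<close>.  Up to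
  isomorphism every small index category has its objects and arrows in \<open>U\<close>.
\<close>

definition preserves_small_colimits ::
  "'i set \<Rightarrow> ('o, 'a) cat \<Rightarrow> ('p, 'b) cat \<Rightarrow> ('o, 'a, 'p, 'b) fctr \<Rightarrow> bool" where
  "preserves_small_colimits U C E F \<longleftrightarrow>
     (\<forall>(J :: ('i, 'i) cat) D c inc.
        category J \<and> Obj J \<subseteq> U \<and> Obj J \<prec> U \<and> Arr J \<subseteq> U \<and> Arr J \<prec> U \<and>
        is_functor J C D \<and> is_colimit J C D c inc \<longrightarrow>
        is_colimit J E \<lparr>fobj = \<lambda>j. fobj F (fobj D j), farr = \<lambda>u. farr F (farr D u)\<rparr>
          (fobj F c) (\<lambda>j. farr F (inc j)))"

definition is_left_adjoint :: "('o, 'a) cat \<Rightarrow> ('p, 'b) cat \<Rightarrow> ('o, 'a, 'p, 'b) fctr \<Rightarrow> bool" where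
  "is_left_adjoint C D F \<longleftrightarrow>
     (\<exists>(G :: ('p, 'b, 'o, 'a) fctr) (\<phi> :: 'o \<Rightarrow> 'p \<Rightarrow> 'b \<Rightarrow> 'a).
        is_functor D C G \<and>
        (\<forall>x\<in>Obj C. \<forall>y\<in>Obj D.
           bij_betw (\<phi> x y) (hom_set D (fobj F x) y) (hom_set C x (fobj G y))) \<and>
        (\<forall>f\<in>Arr C. \<forall>g\<in>Arr D. \<forall>h\<in>hom_set D (fobj F (Cod C f)) (Dom D g).
           \<phi> (Dom C f) (Cod D g) (Comp D g (Comp D h (farr F f))) =
             Comp C (farr G g) (Comp C (\<phi> (Cod C f) (Dom D g) h) f)))"


section \<open>Model structures\<close>

record 'a model =
  weq :: "'a set"
  cof :: "'a set"
  fib :: "'a set"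

definition is_retract :: "('o, 'a) cat \<Rightarrow> 'a \<Rightarrow> 'a \<Rightarrow> bool" where
  "is_retract C f g \<longleftrightarrow>
     (\<exists>s\<in>hom_set C (Dom C f) (Dom C g). \<exists>r\<in>hom_set C (Dom C g) (Dom C f).
      \<exists>s'\<in>hom_set C (Cod C f) (Cod C g). \<exists>r'\<in>hom_set C (Cod C g) (Cod C f).
        Comp C r s = Ident C (Dom C f) \<and> Comp C r' s' = Ident C (Cod C f) \<and>
        Comp C g s = Comp C s' f \<and> Comp C f r = Comp C r' g)"

definition has_lifting :: "('o, 'a) cat \<Rightarrow> 'a \<Rightarrow> 'a \<Rightarrow> bool" where
  "has_lifting C i p \<longleftrightarrow>
     (\<forall>u\<in>hom_set C (Dom C i) (Dom C p). \<forall>v\<in>hom_set C (Cod C i) (Cod C p).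
        Comp C p u = Comp C v i \<longrightarrow>
        (\<exists>l\<in>hom_set C (Cod C i) (Dom C p). Comp C l i = u \<and> Comp C p l = v))"

definition is_model_structure :: "('o, 'a) cat \<Rightarrow> 'a model \<Rightarrow> bool" where
  "is_model_structure C M \<longleftrightarrow>
     weq M \<subseteq> Arr C \<and> cof M \<subseteq> Arr C \<and> fib M \<subseteq> Arr C \<and>
     (\<forall>f\<in>Arr C. \<forall>g\<in>Arr C. Dom C g = Cod C f \<longrightarrow>
        (f \<in> weq M \<and> g \<in> weq M \<longrightarrow> Comp C g f \<in> weq M) \<and>
        (f \<in> weq M \<and> Comp C g f \<in> weq M \<longrightarrow> g \<in> weq M) \<and>
        (g \<in> weq M \<and> Comp C g f \<in> weq M \<longrightarrow> f \<in> weq M)) \<and>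
     (\<forall>K\<in>{weq M, cof M, fib M}. \<forall>f\<in>Arr C. \<forall>g\<in>K. is_retract C f g \<longrightarrow> f \<in> K) \<and>
     (\<forall>i\<in>cof M \<inter> weq M. \<forall>p\<in>fib M. has_lifting C i p) \<and>
     (\<forall>i\<in>cof M. \<forall>p\<in>fib M \<inter> weq M. has_lifting C i p) \<and>
     (\<forall>f\<in>Arr C. \<exists>i\<in>cof M \<inter> weq M. \<exists>p\<in>fib M.
        Dom C p = Cod C i \<and> Comp C p i = f) \<and>
     (\<forall>f\<in>Arr C. \<exists>i\<in>cof M. \<exists>p\<in>fib M \<inter> weq M.
        Dom C p = Cod C i \<and> Comp C p i = f)"

text \<open>
  A model structure on a locally presentable category is combinatorial iff it is cofibrantly
  generated; in a locally presentable category every object is small, so cofibrant generation means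
  that small sets of arrows detect the fibrations and the trivial fibrations.  Local presentability
  is a property of the two fixed categories below, not of a model structure, and is not repeated.
\<close>

definition cofibrantly_generated :: "'i set \<Rightarrow> ('o, 'a) cat \<Rightarrow> 'a model \<Rightarrow> bool" where
  "cofibrantly_generated U C M \<longleftrightarrow>
     (\<exists>I J. I \<subseteq> Arr C \<and> I \<prec> U \<and> J \<subseteq> Arr C \<and> J \<prec> U \<and>
        fib M = {p \<in> Arr C. \<forall>j\<in>J. has_lifting C j p} \<and>
        fib M \<inter> weq M = {p \<in> Arr C. \<forall>i\<in>I. has_lifting C i p})"

definition fibrant :: "('o, 'a) cat \<Rightarrow> 'a model \<Rightarrow> 'o \<Rightarrow> bool" where
  "fibrant C M z \<longleftrightarrow> z \<in> Obj C \<and> (\<forall>t. is_terminal C t \<longrightarrow> hom_set C z t \<subseteq> fib M)"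

definition left_quillen ::
  "('o, 'a) cat \<Rightarrow> 'a model \<Rightarrow> ('p, 'b) cat \<Rightarrow> 'b model \<Rightarrow> ('o, 'a, 'p, 'b) fctr \<Rightarrow> bool" where
  "left_quillen C M D N F \<longleftrightarrow>
     is_functor C D F \<and> is_left_adjoint C D F \<and>
     (\<forall>f\<in>cof M. farr F f \<in> cof N) \<and>
     (\<forall>f\<in>cof M \<inter> weq M. farr F f \<in> cof N \<inter> weq N)"


section \<open>The classes Lambda\<close>

text \<open>
  Throughout, \<open>g\<close>, \<open>g0\<close>, \<open>g1\<close> are arrows from a terminal object to \<open>V\<close>.  Products, coproducts
  and pushouts are not chosen: a canonical map is considered for every choice of them.

  \<open>cyl_end C g X P pV pX e\<close>: for the product \<open>P\<close> of \<open>V = Cod C g\<close> and \<open>X\<close> with projections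
  \<open>pV\<close> and \<open>pX\<close>, \<open>e\<close> is the map from \<open>X\<close> to \<open>P\<close> given by \<open>X \<cong> 1 \<times> X\<close> and \<open>g\<close>.
\<close>

definition cyl_end :: "('o, 'a) cat \<Rightarrow> 'a \<Rightarrow> 'o \<Rightarrow> 'o \<Rightarrow> 'a \<Rightarrow> 'a \<Rightarrow> 'a \<Rightarrow> bool" where
  "cyl_end C g X P pV pX e \<longleftrightarrow>
     is_product C (Cod C g) X P pV pX \<and> e \<in> hom_set C X P \<and>
     Comp C pX e = Ident C X \<and>
     (\<forall>t\<in>hom_set C X (Dom C g). Comp C pV e = Comp C g t)"

text \<open>\<open>prod_map C f P pV pX P' qV qY m\<close>: \<open>m\<close> is the map \<open>V \<times> f\<close> from \<open>P = V \<times> X\<close> to \<open>P' = V \<times> Y\<close>.\<close>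

definition prod_map :: "('o, 'a) cat \<Rightarrow> 'a \<Rightarrow> 'o \<Rightarrow> 'a \<Rightarrow> 'a \<Rightarrow> 'o \<Rightarrow> 'a \<Rightarrow> 'a \<Rightarrow> 'a \<Rightarrow> bool" where
  "prod_map C f P pV pX P' qV qY m \<longleftrightarrow>
     m \<in> hom_set C P P' \<and> Comp C qV m = pV \<and> Comp C qY m = Comp C f pX"

text \<open>\<open>star_end C g f h\<close>: \<open>h\<close> is the canonical map from the pushout of \<open>Y\<close> and \<open>V \<times> X\<close> to \<open>V \<times> Y\<close>.\<close>

definition star_end :: "('o, 'a) cat \<Rightarrow> 'a \<Rightarrow> 'a \<Rightarrow> 'a \<Rightarrow> bool" where
  "star_end C g f h \<longleftrightarrow>
     (\<exists>P pV pX eX P' qV qY eY m Q u v.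
        cyl_end C g (Dom C f) P pV pX eX \<and>
        cyl_end C g (Cod C f) P' qV qY eY \<and>
        prod_map C f P pV pX P' qV qY m \<and>
        is_pushout C f eX Q u v \<and>
        h \<in> hom_set C Q P' \<and> Comp C h u = eY \<and> Comp C h v = m)"

text \<open>
  \<open>star_both C g0 g1 f h\<close>: likewise for both ends at once, the pushout being that of \<open>f \<squnion> f\<close> and the
  map from \<open>X \<squnion> X\<close> to \<open>V \<times> X\<close> given by \<open>g0\<close> and \<open>g1\<close>.
\<close>

definition star_both :: "('o, 'a) cat \<Rightarrow> 'a \<Rightarrow> 'a \<Rightarrow> 'a \<Rightarrow> 'a \<Rightarrow> bool" where
  "star_both C g0 g1 f h \<longleftrightarrow>
     (\<exists>P pV pX eX0 eX1 P' qV qY eY0 eY1 m SX i0 i1 SY j0 j1 ff eX eY Q u v.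
        cyl_end C g0 (Dom C f) P pV pX eX0 \<and> cyl_end C g1 (Dom C f) P pV pX eX1 \<and>
        cyl_end C g0 (Cod C f) P' qV qY eY0 \<and> cyl_end C g1 (Cod C f) P' qV qY eY1 \<and>
        prod_map C f P pV pX P' qV qY m \<and>
        is_coproduct C (Dom C f) (Dom C f) SX i0 i1 \<and>
        is_coproduct C (Cod C f) (Cod C f) SY j0 j1 \<and>
        ff \<in> hom_set C SX SY \<and> Comp C ff i0 = Comp C j0 f \<and> Comp C ff i1 = Comp C j1 f \<and>
        eX \<in> hom_set C SX P \<and> Comp C eX i0 = eX0 \<and> Comp C eX i1 = eX1 \<and>
        eY \<in> hom_set C SY P' \<and> Comp C eY j0 = eY0 \<and> Comp C eY j1 = eY1 \<and>
        is_pushout C ff eX Q u v \<and>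
        h \<in> hom_set C Q P' \<and> Comp C h u = eY \<and> Comp C h v = m)"

inductive_set Lambda :: "('o, 'a) cat \<Rightarrow> 'a \<Rightarrow> 'a \<Rightarrow> 'a set \<Rightarrow> 'a set"
  for C g0 g1 I where
  end0: "f \<in> I \<Longrightarrow> star_end C g0 f h \<Longrightarrow> h \<in> Lambda C g0 g1 I"
| end1: "f \<in> I \<Longrightarrow> star_end C g1 f h \<Longrightarrow> h \<in> Lambda C g0 g1 I"
| both: "f \<in> Lambda C g0 g1 I \<Longrightarrow> star_both C g0 g1 f h \<Longrightarrow> h \<in> Lambda C g0 g1 I"

definition injective_object :: "('o, 'a) cat \<Rightarrow> 'a set \<Rightarrow> 'o \<Rightarrow> bool" where
  "injective_object C K z \<longleftrightarrow>
     z \<in> Obj C \<and>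
     (\<forall>f\<in>K. \<forall>a\<in>hom_set C (Dom C f) z. \<exists>b\<in>hom_set C (Cod C f) z. Comp C b f = a)"


section \<open>The universe\<close>

text \<open>
  All carriers are subsets of one type, which is closed under the constructions needed to write
  down cubes, words and pairs.  A set is small if it has strictly smaller cardinality than this
  type.  If the cardinal of the type is strongly inaccessible, which happens when that of \<open>'u\<close> is,
  the small sets form the category of sets of a Grothendieck universe.
\<close>

datatype 'u elem =
    Atom 'u
  | Num nat
  | Bits "bool list"
  | Cmap (cmap: "bool list \<Rightarrow> bool list")
  | Tup (letters: "'u elem list")

definition small :: "'u elem set \<Rightarrow> bool" where
  "small A \<longleftrightarrow> A \<prec> (UNIV :: 'u elem set)"

definition first_letter :: "'u elem \<Rightarrow> 'u elem" where
  "first_letter x = letters x ! 0"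

text \<open>The \<open>i\<close>-th copy \<open>(x, i)\<close> of \<open>x\<close>.\<close>

definition copy :: "nat \<Rightarrow> 'u elem \<Rightarrow> 'u elem" where
  "copy i x = Tup [x, Num i]"


section \<open>Weak higher dimensional transition systems\<close>

text \<open>\<open>Sg\<close> is the set of labels. Values of \<open>lab\<close> outside \<open>actions\<close> are irrelevant.\<close>

record 'u whdts =
  states :: "'u elem set"
  actions :: "'u elem set"
  lab :: "'u elem \<Rightarrow> 'u elem"
  trans :: "('u elem \<times> 'u elem list \<times> 'u elem) set"

definition is_whdts :: "'u elem set \<Rightarrow> 'u whdts \<Rightarrow> bool" where
  "is_whdts Sg X \<longleftrightarrow>
     small (states X) \<and> small (actions X) \<and>
     lab X \<in> actions X \<rightarrow> Sg \<and>
     (\<forall>\<alpha> us \<beta>. (\<alpha>, us, \<beta>) \<in> trans X \<longrightarrow>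
        \<alpha> \<in> states X \<and> \<beta> \<in> states X \<and> set us \<subseteq> actions X \<and> length us \<ge> 1) \<and>
     (\<forall>\<alpha> us \<beta> \<sigma>. (\<alpha>, us, \<beta>) \<in> trans X \<and> length us \<ge> 2 \<and> \<sigma> permutes {..<length us} \<longrightarrow>
        (\<alpha>, permute_list \<sigma> us, \<beta>) \<in> trans X) \<and>
     (\<forall>\<alpha> us \<beta> \<nu>\<^sub>1 \<nu>\<^sub>2 p q.
        length us \<ge> 3 \<and> p \<ge> 1 \<and> q \<ge> 1 \<and> p + q < length us \<and>
        (\<alpha>, us, \<beta>) \<in> trans X \<and>
        (\<alpha>, take p us, \<nu>\<^sub>1) \<in> trans X \<and> (\<nu>\<^sub>1, drop p us, \<beta>) \<in> trans X \<and>
        (\<alpha>, take (p + q) us, \<nu>\<^sub>2) \<in> trans X \<and> (\<nu>\<^sub>2, drop (p + q) us, \<beta>) \<in> trans X \<longrightarrow>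
        (\<nu>\<^sub>1, take q (drop p us), \<nu>\<^sub>2) \<in> trans X)"

record 'u ts_map =
  ts_dom :: "'u whdts"
  ts_cod :: "'u whdts"
  on_states :: "'u elem \<Rightarrow> 'u elem"
  on_actions :: "'u elem \<Rightarrow> 'u elem"

definition mk_ts_map ::
  "'u whdts \<Rightarrow> 'u whdts \<Rightarrow> ('u elem \<Rightarrow> 'u elem) \<Rightarrow> ('u elem \<Rightarrow> 'u elem) \<Rightarrow> 'u ts_map" where
  "mk_ts_map X Y s a =
     \<lparr>ts_dom = X, ts_cod = Y, on_states = restrict s (states X), on_actions = restrict a (actions X)\<rparr>"

definition WHDTS :: "'u elem set \<Rightarrow> ('u whdts, 'u ts_map) cat" where
  "WHDTS Sg =
     \<lparr>Obj = {X. is_whdts Sg X},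
      Arr = {f. is_whdts Sg (ts_dom f) \<and> is_whdts Sg (ts_cod f) \<and>
                on_states f \<in> states (ts_dom f) \<rightarrow>\<^sub>E states (ts_cod f) \<and>
                on_actions f \<in> actions (ts_dom f) \<rightarrow>\<^sub>E actions (ts_cod f) \<and>
                (\<forall>u\<in>actions (ts_dom f). lab (ts_cod f) (on_actions f u) = lab (ts_dom f) u) \<and>
                (\<forall>\<alpha> us \<beta>. (\<alpha>, us, \<beta>) \<in> trans (ts_dom f) \<longrightarrow>
                   (on_states f \<alpha>, map (on_actions f) us, on_states f \<beta>) \<in> trans (ts_cod f))},
      Dom = ts_dom,
      Cod = ts_cod,
      Ident = (\<lambda>X. mk_ts_map X X (\<lambda>s. s) (\<lambda>u. u)),
      Comp = (\<lambda>g f. mk_ts_map (ts_dom f) (ts_cod g)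
                (\<lambda>s. on_states g (on_states f s)) (\<lambda>u. on_actions g (on_actions f u)))\<rparr>"

text \<open>Coordinates are numbered from \<open>0\<close>; \<open>False \<le> True\<close> stands for \<open>0 \<le> 1\<close>.\<close>

definition cube :: "'u elem list \<Rightarrow> 'u whdts" where
  "cube xs =
     (let n = length xs; act = (\<lambda>i. copy i (xs ! i)) in
      \<lparr>states = Bits ` {e. length e = n},
       actions = act ` {..<n},
       lab = first_letter,
       trans = {(Bits e, map act is, Bits e') | e is e'.
                  length e = n \<and> length e' = n \<and> is \<noteq> [] \<and> distinct is \<and> set is \<subseteq> {..<n} \<and>
                  (\<forall>i<n. e ! i \<le> e' ! i) \<and> (\<forall>i<n. e ! i \<noteq> e' ! i \<longleftrightarrow> i \<in> set is)}\<rparr>)"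

definition boundary_cube :: "'u elem list \<Rightarrow> 'u whdts" where
  "boundary_cube xs =
     (cube xs)\<lparr>trans := {(\<alpha>, us, \<beta>). (\<alpha>, us, \<beta>) \<in> trans (cube xs) \<and> length us \<noteq> length xs}\<rparr>"

definition double_transition :: "'u elem \<Rightarrow> 'u whdts" where
  "double_transition x =
     \<lparr>states = {Num 1, Num 2, Num 3, Num 4}, actions = {x}, lab = (\<lambda>u. u),
      trans = {(Num 1, [x], Num 2), (Num 3, [x], Num 4)}\<rparr>"

definition discrete :: "'u elem set \<Rightarrow> 'u whdts" where
  "discrete S = \<lparr>states = S, actions = {}, lab = (\<lambda>u. u), trans = {}\<rparr>"

definition one_state :: "'u elem set \<Rightarrow> ('u elem \<Rightarrow> 'u elem) \<Rightarrow> 'u whdts" where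
  "one_state L \<mu> =
     \<lparr>states = {Num 0}, actions = L, lab = \<mu>,
      trans = {(Num 0, us, Num 0) | us. us \<noteq> [] \<and> set us \<subseteq> L}\<rparr>"


section \<open>Cubical transition systems\<close>

definition cubes_of :: "'u elem set \<Rightarrow> 'u whdts \<Rightarrow> 'u ts_map set" where
  "cubes_of Sg X = {f \<in> Arr (WHDTS Sg). ts_cod f = X \<and> (\<exists>xs\<in>lists Sg. ts_dom f = cube xs)}"

definition cubical_part :: "'u elem set \<Rightarrow> 'u whdts \<Rightarrow> 'u whdts" where
  "cubical_part Sg X =
     \<lparr>states = (\<Union>f\<in>cubes_of Sg X. on_states f ` states (ts_dom f)),
      actions = (\<Union>f\<in>cubes_of Sg X. on_actions f ` actions (ts_dom f)),
      lab = lab X,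
      trans = (\<Union>f\<in>cubes_of Sg X.
        (\<lambda>(\<alpha>, us, \<beta>). (on_states f \<alpha>, map (on_actions f) us, on_states f \<beta>)) ` trans (ts_dom f))\<rparr>"

definition cubical :: "'u elem set \<Rightarrow> 'u whdts \<Rightarrow> bool" where
  "cubical Sg X \<longleftrightarrow> cubical_part Sg X = X"

definition CTS :: "'u elem set \<Rightarrow> ('u whdts, 'u ts_map) cat" where
  "CTS Sg = full_subcategory (WHDTS Sg) {X. cubical Sg X}"

definition cts_interval :: "'u elem set \<Rightarrow> 'u whdts" where
  "cts_interval Sg = one_state (copy 0 ` Sg \<union> copy 1 ` Sg) first_letter"

definition cts_end :: "'u elem set \<Rightarrow> nat \<Rightarrow> 'u ts_map" where
  "cts_end Sg k = mk_ts_map (one_state Sg (\<lambda>x. x)) (cts_interval Sg) (\<lambda>s. s) (copy k)"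

text \<open>
  After removal of its 1-transition, the 1-cube keeps an action which occurs in no transition, so
  it is not cubical.  In the category of cubical transition systems the boundary therefore has to
  be read as the union of the images of its cubes; this only drops that action, and changes nothing
  in dimensions at least 2.
\<close>

definition cts_generators :: "'u elem set \<Rightarrow> 'u ts_map set" where
  "cts_generators Sg =
     {mk_ts_map (discrete {}) (discrete {Num 0}) (\<lambda>s. s) (\<lambda>u. u),
      mk_ts_map (discrete {Num 0, Num 1}) (discrete {Num 0}) (\<lambda>s. Num 0) (\<lambda>u. u)} \<union>
     {mk_ts_map (cubical_part Sg (boundary_cube xs)) (cube xs) (\<lambda>s. s) (\<lambda>u. u) | xs.
        xs \<in> lists Sg \<and> length xs \<ge> 1} \<union>
     {mk_ts_map (cube [x]) (double_transition x)
        (\<lambda>s. if s = Bits [False] then Num 1 else Num 2) (\<lambda>u. x) | x. x \<in> Sg}"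

definition cts_cofibrations :: "'u elem set \<Rightarrow> 'u ts_map set" where
  "cts_cofibrations Sg = {f \<in> Arr (CTS Sg). inj_on (on_actions f) (actions (ts_dom f))}"

definition is_cts_model :: "'u elem set \<Rightarrow> 'u ts_map model \<Rightarrow> bool" where
  "is_cts_model Sg M \<longleftrightarrow>
     is_model_structure (CTS Sg) M \<and>
     cofibrantly_generated (UNIV :: 'u elem set) (CTS Sg) M \<and>
     cof M = cts_cofibrations Sg \<and>
     (\<forall>Z\<in>Obj (CTS Sg). fibrant (CTS Sg) M Z \<longleftrightarrow>
        injective_object (CTS Sg)
          (Lambda (CTS Sg) (cts_end Sg 0) (cts_end Sg 1) (cts_generators Sg)) Z)"


section \<open>Labelled symmetric precubical sets\<close>

definition box :: "nat \<Rightarrow> bool list set" where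
  "box n = {b. length b = n}"

text \<open>\<open>cube_map m n f\<close>: \<open>f\<close> is a morphism from \<open>[m]\<close> to \<open>[n]\<close>, undefined outside \<open>box m\<close>.\<close>

inductive cube_map :: "nat \<Rightarrow> nat \<Rightarrow> (bool list \<Rightarrow> bool list) \<Rightarrow> bool" where
  ident: "cube_map n n (restrict (\<lambda>b. b) (box n))"
| face: "i \<le> n \<Longrightarrow> cube_map n (Suc n) (restrict (\<lambda>b. take i b @ \<alpha> # drop i b) (box n))"
| swap: "Suc i < n \<Longrightarrow> cube_map n n (restrict (\<lambda>b. b[i := b ! Suc i, Suc i := b ! i]) (box n))"
| comp: "cube_map m n f \<Longrightarrow> cube_map n p g \<Longrightarrow> cube_map m p (compose (box m) g f)"

text \<open>
  A presheaf on the category of these maps: \<open>psh_act K m n f\<close> is the contravariant action of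
  \<open>f : [m] \<rightarrow> [n]\<close>. Its values elsewhere are irrelevant.
\<close>

record 'u psh =
  cells :: "nat \<Rightarrow> 'u elem set"
  psh_act :: "nat \<Rightarrow> nat \<Rightarrow> (bool list \<Rightarrow> bool list) \<Rightarrow> 'u elem \<Rightarrow> 'u elem"

definition is_psh :: "'u psh \<Rightarrow> bool" where
  "is_psh K \<longleftrightarrow>
     (\<forall>n. small (cells K n)) \<and>
     (\<forall>m n f. cube_map m n f \<longrightarrow> psh_act K m n f \<in> cells K n \<rightarrow> cells K m) \<and>
     (\<forall>n. \<forall>x\<in>cells K n. psh_act K n n (restrict (\<lambda>b. b) (box n)) x = x) \<and>
     (\<forall>m n p f g. cube_map m n f \<and> cube_map n p g \<longrightarrow>
        (\<forall>x\<in>cells K p. psh_act K m p (compose (box m) g f) x = psh_act K m n f (psh_act K n p g x)))"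

record 'u psh_map =
  psh_dom :: "'u psh"
  psh_cod :: "'u psh"
  on_cells :: "nat \<Rightarrow> 'u elem \<Rightarrow> 'u elem"

definition mk_psh_map :: "'u psh \<Rightarrow> 'u psh \<Rightarrow> (nat \<Rightarrow> 'u elem \<Rightarrow> 'u elem) \<Rightarrow> 'u psh_map" where
  "mk_psh_map K L h = \<lparr>psh_dom = K, psh_cod = L, on_cells = (\<lambda>n. restrict (h n) (cells K n))\<rparr>"

definition PSH :: "('u psh, 'u psh_map) cat" where
  "PSH =
     \<lparr>Obj = {K. is_psh K},
      Arr = {f. is_psh (psh_dom f) \<and> is_psh (psh_cod f) \<and>
                (\<forall>n. on_cells f n \<in> cells (psh_dom f) n \<rightarrow>\<^sub>E cells (psh_cod f) n) \<and>
                (\<forall>m n h. cube_map m n h \<longrightarrow> (\<forall>x\<in>cells (psh_dom f) n.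
                   on_cells f m (psh_act (psh_dom f) m n h x) =
                     psh_act (psh_cod f) m n h (on_cells f n x)))},
      Dom = psh_dom,
      Cod = psh_cod,
      Ident = (\<lambda>K. mk_psh_map K K (\<lambda>n x. x)),
      Comp = (\<lambda>g f. mk_psh_map (psh_dom f) (psh_cod g) (\<lambda>n x. on_cells g n (on_cells f n x)))\<rparr>"

definition box_psh :: "nat \<Rightarrow> 'u psh" where
  "box_psh n =
     \<lparr>cells = (\<lambda>m. Cmap ` {f. cube_map m n f}),
      psh_act = (\<lambda>m p f x. Cmap (compose (box m) (cmap x) f))\<rparr>"

definition boundary_psh :: "nat \<Rightarrow> 'u psh" where
  "boundary_psh n = (box_psh n)\<lparr>cells := (\<lambda>m. if m < n then cells (box_psh n) m else {})\<rparr>"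

text \<open>A coproduct of copies of the representable presheaf of degree \<open>0\<close>.\<close>

definition set_psh :: "'u elem set \<Rightarrow> 'u psh" where
  "set_psh S = \<lparr>cells = (\<lambda>n. if n = 0 then S else {}), psh_act = (\<lambda>m n f x. x)\<rparr>"

text \<open>
  For a morphism \<open>f : [m] \<rightarrow> [n]\<close>, each input coordinate \<open>j\<close> occurs as exactly one output
  coordinate.  A morphism acts on words by reading off the letters at these positions; the two
  lemmas below show that faces delete a letter and symmetries exchange adjacent letters.
\<close>

definition coord :: "nat \<Rightarrow> nat \<Rightarrow> (bool list \<Rightarrow> bool list) \<Rightarrow> nat \<Rightarrow> nat" where
  "coord m n f j = (THE i. i < n \<and> (\<forall>b\<in>box m. f b ! i = b ! j))"

definition word_act :: "nat \<Rightarrow> nat \<Rightarrow> (bool list \<Rightarrow> bool list) \<Rightarrow> 'u elem list \<Rightarrow> 'u elem list" where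
  "word_act m n f xs = map (\<lambda>j. xs ! coord m n f j) [0..<m]"

lemma coord_eqI:
  assumes i: "i < n" and f: "\<And>b. b \<in> box m \<Longrightarrow> f b ! i = b ! j"
    and other: "\<And>k. k < n \<Longrightarrow> k \<noteq> i \<Longrightarrow> \<exists>b\<in>box m. f b ! k \<noteq> b ! j"
  shows "coord m n f j = i"
  unfolding coord_def using assms by (intro the_equality) blast+

lemma word_act_face:
  assumes "i \<le> n" "length xs = Suc n"
  shows "word_act n (Suc n) (restrict (\<lambda>b. take i b @ \<alpha> # drop i b) (box n)) xs =
         take i xs @ drop (Suc i) xs"
proof (rule nth_equalityI)
  let ?f = "restrict (\<lambda>b. take i b @ \<alpha> # drop i b) (box n)"
  show "length (word_act n (Suc n) ?f xs) = length (take i xs @ drop (Suc i) xs)"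
    using assms by (simp add: word_act_def)
  fix j assume "j < length (word_act n (Suc n) ?f xs)"
  then have j: "j < n" by (simp add: word_act_def)
  have f: "?f b ! k = (if k < i then b ! k else if k = i then \<alpha> else b ! (k - 1))"
    if "b \<in> box n" "k < Suc n" for b k
    using that assms(1) by (auto simp: box_def nth_append nth_Cons')
  have "coord n (Suc n) ?f j = (if j < i then j else Suc j)"
  proof (rule coord_eqI)
    show "(if j < i then j else Suc j) < Suc n" using j by auto
    show "?f b ! (if j < i then j else Suc j) = b ! j" if "b \<in> box n" for b
      using f[OF that, of "if j < i then j else Suc j"] j by (auto split: if_splits)
    show "\<exists>b\<in>box n. ?f b ! k \<noteq> b ! j" if k: "k < Suc n" "k \<noteq> (if j < i then j else Suc j)" for k
    proof (cases "k = i")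
      case True
      have "(replicate n (\<not> \<alpha>)) \<in> box n" by (simp add: box_def)
      with f[OF this k(1)] True j show ?thesis by force
    next
      case False
      let ?b = "(replicate n False)[j := True]"
      have b: "?b \<in> box n" by (simp add: box_def)
      have "?f ?b ! k = False"
        using f[OF b k(1)] False k j assms(1) by (auto simp: nth_list_update split: if_splits)
      moreover have "?b ! j" using j by simp
      ultimately show ?thesis using b by metis
    qed
  qed
  then show "word_act n (Suc n) ?f xs ! j = (take i xs @ drop (Suc i) xs) ! j"
    using j assms by (auto simp: word_act_def nth_append)
qed

lemma word_act_swap:
  assumes "Suc i < n" "length xs = n"
  shows "word_act n n (restrict (\<lambda>b. b[i := b ! Suc i, Suc i := b ! i]) (box n)) xs =
         xs[i := xs ! Suc i, Suc i := xs ! i]"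
proof (rule nth_equalityI)
  let ?f = "restrict (\<lambda>b. b[i := b ! Suc i, Suc i := b ! i]) (box n)"
  let ?t = "\<lambda>j. if j = i then Suc i else if j = Suc i then i else j"
  show "length (word_act n n ?f xs) = length (xs[i := xs ! Suc i, Suc i := xs ! i])"
    using assms by (simp add: word_act_def)
  fix j assume "j < length (word_act n n ?f xs)"
  then have j: "j < n" by (simp add: word_act_def)
  have f: "?f b ! k = b ! ?t k" if "b \<in> box n" "k < n" for b k
    using that assms(1) by (auto simp: box_def nth_list_update)
  have "coord n n ?f j = ?t j"
  proof (rule coord_eqI)
    show "?t j < n" using j assms by auto
    show "?f b ! ?t j = b ! j" if "b \<in> box n" for b
      using f[OF that, of "?t j"] j assms by (auto split: if_splits)
    show "\<exists>b\<in>box n. ?f b ! k \<noteq> b ! j" if k: "k < n" "k \<noteq> ?t j" for k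
    proof -
      let ?b = "(replicate n False)[j := True]"
      have b: "?b \<in> box n" by (simp add: box_def)
      have "?t k \<noteq> j" "?t k < n" using k assms by (auto split: if_splits)
      then have "?f ?b ! k = False" using f[OF b k(1)] by (simp add: nth_list_update)
      moreover have "?b ! j" using j by simp
      ultimately show ?thesis using b by metis
    qed
  qed
  then show "word_act n n ?f xs ! j = xs[i := xs ! Suc i, Suc i := xs ! i] ! j"
    using j assms by (auto simp: word_act_def nth_list_update)
qed

definition words_psh :: "'u elem set \<Rightarrow> 'u psh" where
  "words_psh A =
     \<lparr>cells = (\<lambda>n. Tup ` {xs \<in> lists A. length xs = n}),
      psh_act = (\<lambda>m n f x. Tup (word_act m n f (letters x)))\<rparr>"

definition LSP :: "'u elem set \<Rightarrow> ('u psh_map, 'u psh_map slice_arr) cat" where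
  "LSP Sg = slice PSH (words_psh Sg)"

definition lab_box :: "'u elem set \<Rightarrow> 'u elem list \<Rightarrow> 'u psh_map" where
  "lab_box Sg as = mk_psh_map (box_psh (length as)) (words_psh Sg)
     (\<lambda>m x. Tup (word_act m (length as) (cmap x) as))"

definition lab_boundary :: "'u elem set \<Rightarrow> 'u elem list \<Rightarrow> 'u psh_map" where
  "lab_boundary Sg as = mk_psh_map (boundary_psh (length as)) (words_psh Sg)
     (\<lambda>m x. Tup (word_act m (length as) (cmap x) as))"

definition lab_set :: "'u elem set \<Rightarrow> 'u elem set \<Rightarrow> 'u psh_map" where
  "lab_set Sg S = mk_psh_map (set_psh S) (words_psh Sg) (\<lambda>m x. Tup [])"

definition mk_lsp_map ::
  "'u psh_map \<Rightarrow> 'u psh_map \<Rightarrow> (nat \<Rightarrow> 'u elem \<Rightarrow> 'u elem) \<Rightarrow> 'u psh_map slice_arr" where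
  "mk_lsp_map p q h = \<lparr>sl_dom = p, sl_arr = mk_psh_map (psh_dom p) (psh_dom q) h, sl_cod = q\<rparr>"

definition lsp_interval :: "'u elem set \<Rightarrow> 'u psh_map" where
  "lsp_interval Sg = mk_psh_map (words_psh (copy 0 ` Sg \<union> copy 1 ` Sg)) (words_psh Sg)
     (\<lambda>n w. Tup (map first_letter (letters w)))"

definition lsp_end :: "'u elem set \<Rightarrow> nat \<Rightarrow> 'u psh_map slice_arr" where
  "lsp_end Sg k = mk_lsp_map (mk_psh_map (words_psh Sg) (words_psh Sg) (\<lambda>n w. w)) (lsp_interval Sg)
     (\<lambda>n w. Tup (map (copy k) (letters w)))"

definition lsp_generators :: "'u elem set \<Rightarrow> 'u psh_map slice_arr set" where
  "lsp_generators Sg =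
     {mk_lsp_map (lab_boundary Sg as) (lab_box Sg as) (\<lambda>n x. x) | as.
        as \<in> lists Sg \<and> length as \<ge> 1} \<union>
     {mk_lsp_map (lab_set Sg {}) (lab_set Sg {Num 0}) (\<lambda>n x. x),
      mk_lsp_map (lab_set Sg {Num 0, Num 1}) (lab_set Sg {Num 0}) (\<lambda>n x. Num 0)}"

definition lsp_cofibrations :: "'u elem set \<Rightarrow> 'u psh_map slice_arr set" where
  "lsp_cofibrations Sg =
     {t \<in> Arr (LSP Sg). \<forall>n\<ge>1. inj_on (on_cells (sl_arr t) n) (cells (psh_dom (sl_arr t)) n)}"

definition is_lsp_model :: "'u elem set \<Rightarrow> 'u psh_map slice_arr model \<Rightarrow> bool" where
  "is_lsp_model Sg M \<longleftrightarrow>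
     is_model_structure (LSP Sg) M \<and>
     cofibrantly_generated (UNIV :: 'u elem set) (LSP Sg) M \<and>
     cof M = lsp_cofibrations Sg \<and>
     (\<forall>Z\<in>Obj (LSP Sg). fibrant (LSP Sg) M Z \<longleftrightarrow>
        injective_object (LSP Sg)
          (Lambda (LSP Sg) (lsp_end Sg 0) (lsp_end Sg 1) (lsp_generators Sg)) Z)"


section \<open>The realization functor\<close>

text \<open>
  A 0-cube of the representable presheaf of degree \<open>n\<close> is a map from \<open>[0] = {[]}\<close> to \<open>[n]\<close>; it is
  identified with its value at \<open>[]\<close>, which is a state of the \<open>n\<close>-cube.
\<close>

definition vertex :: "bool list \<Rightarrow> 'u elem" where
  "vertex e = Cmap (restrict (\<lambda>b. e) (box 0))"

definition is_realization ::
  "'u elem set \<Rightarrow> ('u psh_map, 'u psh_map slice_arr, 'u whdts, 'u ts_map) fctr \<Rightarrow> bool" where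
  "is_realization Sg T \<longleftrightarrow>
     is_functor (LSP Sg) (CTS Sg) T \<and>
     preserves_small_colimits (UNIV :: 'u elem set) (LSP Sg) (CTS Sg) T \<and>
     (\<forall>as\<in>lists Sg. fobj T (lab_box Sg as) = cube as) \<and>
     (\<forall>as\<in>lists Sg. \<forall>bs\<in>lists Sg. \<forall>f\<in>hom_set (LSP Sg) (lab_box Sg as) (lab_box Sg bs).
        \<forall>e\<in>box (length as).
          on_states (farr T f) (Bits e) = Bits (cmap (on_cells (sl_arr f) 0 (vertex e)) []))"

end

theory Submission
  imports Defs
begin

text \<open>
  The realization already fails to preserve cofibrations.  Let \<open>B\<close> be the boundary of the square
  labelled by \<open>x, x\<close>.  The inclusion of \<open>B\<close> into the square is a cofibration, and its realization
  identifies the actions of two parallel edges.  But \<open>B\<close> also admits a map to the square which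
  folds it along the diagonal, so that two parallel edges of \<open>B\<close> become consecutive ones; the
  realization of this second map sends the same two actions to different ones.  Hence they differ
  in the realization of \<open>B\<close>, and the realized inclusion is not injective on actions.
\<close>

section \<open>Coordinates of cube maps\<close>

text \<open>Induction over the generators: a face inserts a constant, a symmetry permutes, and
  composition preserves this shape. The position \<open>c j\<close> carries input \<open>j\<close>;
  \<open>d\<close> gives the constants elsewhere.\<close>

lemma cube_map_coordinates:
  assumes "cube_map m n f"
  shows "\<exists>c d. f \<in> box m \<rightarrow>\<^sub>E box n \<and> inj_on c {..<m} \<and> c ` {..<m} \<subseteq> {..<n} \<and>
    (\<forall>b\<in>box m. (\<forall>j<m. f b ! c j = b ! j) \<and> (\<forall>i<n. i \<notin> c ` {..<m} \<longrightarrow> f b ! i = d i))"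
  using assms
proof induction
  case (ident n)
  show ?case
    \<comment> \<open>Here \<open>c\<close> hits every position, so \<open>True\<close> is only a
      placeholder for \<open>d\<close>.\<close>
    by (rule exI[of _ "\<lambda>j. j"], rule exI[of _ "\<lambda>_. True"]) auto
next
  case (face i n \<alpha>)
  let ?f = "restrict (\<lambda>b. take i b @ \<alpha> # drop i b) (box n)"
  let ?c = "\<lambda>j. if j < i then j else Suc j"
  have 1: "?f \<in> box n \<rightarrow>\<^sub>E box (Suc n)"
    by (auto simp: restrict_PiE_iff box_def)
  have 2: "inj_on ?c {..<n}"
    by (auto simp: inj_on_def split: if_splits)
  have 3: "?c ` {..<n} \<subseteq> {..<Suc n}"
    by auto
  have "k = i" if "k < Suc n" "k \<notin> ?c ` {..<n}" for k
  proof (rule ccontr)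
    assume "k \<noteq> i"
    then have "k = ?c (if k < i then k else k - 1)" "(if k < i then k else k - 1) < n"
      using that(1) face by (auto split: if_splits)
    then show False using that(2) by blast
  qed
  moreover have "?f b ! i = \<alpha>" if "b \<in> box n" for b
    using that face by (auto simp: box_def nth_append)
  ultimately have 4: "\<forall>k<Suc n. k \<notin> ?c ` {..<n} \<longrightarrow> ?f b ! k = \<alpha>" if "b \<in> box n" for b
    using that by blast
  have 5: "\<forall>j<n. ?f b ! ?c j = b ! j" if "b \<in> box n" for b
    using that face by (auto simp: box_def nth_append)
  show ?case
    by (rule exI[of _ ?c], rule exI[of _ "\<lambda>_. \<alpha>"]) (intro conjI ballI 1 2 3 4 5)
next
  case (swap i n)
  let ?f = "restrict (\<lambda>b. b[i := b ! Suc i, Suc i := b ! i]) (box n)"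
  let ?t = "\<lambda>j. if j = i then Suc i else if j = Suc i then i else j"
  have 1: "?f \<in> box n \<rightarrow>\<^sub>E box n"
    by (auto simp: restrict_PiE_iff box_def)
  have 2: "inj_on ?t {..<n}"
    by (auto simp: inj_on_def split: if_splits)
  have 3: "?t ` {..<n} \<subseteq> {..<n}"
    using swap by auto
  have "k \<in> ?t ` {..<n}" if "k < n" for k
  proof
    show "k = ?t (?t k)" by auto
    show "?t k \<in> {..<n}" using that swap by auto
  qed
  then have 4: "\<forall>k<n. k \<notin> ?t ` {..<n} \<longrightarrow> ?f b ! k = True" for b
    by blast
  have 5: "\<forall>j<n. ?f b ! ?t j = b ! j" if "b \<in> box n" for b
    using that swap by (auto simp: box_def nth_list_update)
  show ?case
    by (rule exI[of _ ?t], rule exI[of _ "\<lambda>_. True"]) (intro conjI ballI 1 2 3 4 5)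
next
  case (comp m n f p g)
  obtain c d where f: "f \<in> box m \<rightarrow>\<^sub>E box n" "inj_on c {..<m}" "c ` {..<m} \<subseteq> {..<n}"
      "\<forall>b\<in>box m. (\<forall>j<m. f b ! c j = b ! j) \<and> (\<forall>i<n. i \<notin> c ` {..<m} \<longrightarrow> f b ! i = d i)"
    using comp.IH(1) by (elim exE conjE) (rule that)
  obtain c' d' where g: "g \<in> box n \<rightarrow>\<^sub>E box p" "inj_on c' {..<n}" "c' ` {..<n} \<subseteq> {..<p}"
      "\<forall>b\<in>box n. (\<forall>j<n. g b ! c' j = b ! j) \<and> (\<forall>i<p. i \<notin> c' ` {..<n} \<longrightarrow> g b ! i = d' i)"
    using comp.IH(2) by (elim exE conjE) (rule that)
  \<comment> \<open>A position missed by the composite is either in the image of \<open>c'\<close>,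
    where \<open>g\<close> copies a constant of \<open>f\<close>, or already constant for
    \<open>g\<close>.\<close>
  define e where "e i = (if i \<in> c' ` {..<n} then d (the_inv_into {..<n} c' i) else d' i)" for i
  let ?c = "\<lambda>j. c' (c j)"
  have fb: "f b \<in> box n" if "b \<in> box m" for b
    using that f(1) by (rule PiE_mem[rotated])
  have c: "c j < n" if "j < m" for j
    using that f(3) by blast
  have 1: "compose (box m) g f \<in> box m \<rightarrow>\<^sub>E box p"
    using fb PiE_mem[OF g(1)] by (simp add: compose_def restrict_PiE_iff)
  have 2: "inj_on ?c {..<m}"
    using comp_inj_on[OF f(2) inj_on_subset[OF g(2) f(3)]] by (simp add: comp_def)
  have 3: "?c ` {..<m} \<subseteq> {..<p}"
    using g(3) c by auto
  have 4: "\<forall>j<m. compose (box m) g f b ! ?c j = b ! j" if "b \<in> box m" for b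
    using that f(4) g(4) by (simp add: compose_eq fb c)
  have "compose (box m) g f b ! i = e i"
    if b: "b \<in> box m" and i: "i < p" "i \<notin> ?c ` {..<m}" for b i
  proof (cases "i \<in> c' ` {..<n}")
    case True
    then obtain k where k: "k < n" "i = c' k" by blast
    then have "k \<notin> c ` {..<m}" using i(2) by auto
    then have "f b ! k = d k" using f(4) b k(1) by blast
    moreover have "g (f b) ! i = f b ! k" using g(4) fb[OF b] k by blast
    moreover have "e i = d k" using True k g(2) by (simp add: e_def the_inv_into_f_f)
    ultimately show ?thesis using b by (simp add: compose_eq)
  next
    case False
    then show ?thesis using b i(1) g(4) fb[OF b] by (simp add: compose_eq e_def)
  qed
  then have 5: "\<forall>i<p. i \<notin> ?c ` {..<m} \<longrightarrow> compose (box m) g f b ! i = e i" if "b \<in> box m" for b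
    using that by simp
  show ?case
    by (rule exI[of _ ?c], rule exI[of _ e]) (intro conjI ballI 1 2 3 4 5)
qed

lemma cube_map_PiE: "cube_map m n f \<Longrightarrow> f \<in> box m \<rightarrow>\<^sub>E box n"
  by (drule cube_map_coordinates) (elim exE conjE)

lemma cube_map_in_box: "cube_map m n f \<Longrightarrow> b \<in> box m \<Longrightarrow> f b \<in> box n"
  by (drule cube_map_PiE) (rule PiE_mem)

lemma cube_map_funcset: "cube_map m n f \<Longrightarrow> f \<in> box m \<rightarrow> box n"
  by (simp add: cube_map_in_box)

lemma cube_map_extensional: "cube_map m n f \<Longrightarrow> f \<in> extensional (box m)"
  by (drule cube_map_PiE) (simp add: PiE_def)

lemma cube_map_compose_id: "cube_map m n f \<Longrightarrow> compose (box m) (\<lambda>b. b) f = f"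
  using cube_map_extensional by (simp add: compose_def extensional_restrict)

lemma cube_map_dim_le:
  assumes "cube_map m n f"
  shows "m \<le> n"
proof -
  obtain c :: "nat \<Rightarrow> nat" where "inj_on c {..<m}" "c ` {..<m} \<subseteq> {..<n}"
    using cube_map_coordinates[OF assms] by (elim exE conjE) (rule that)
  then show ?thesis
    using card_inj_on_le[of c "{..<m}" "{..<n}"] by simp
qed

text \<open>Vertices tell the input coordinates apart from one another and from constants, so the
  description in \<open>coord\<close> singles out one position, the \<open>c j\<close> of the
  induction.\<close>

lemma
  assumes f: "cube_map m n f" and j: "j < m"
  shows coord_less: "coord m n f j < n"
    and nth_coord: "b \<in> box m \<Longrightarrow> f b ! coord m n f j = b ! j"
    and coord_unique: "i < n \<Longrightarrow> (\<And>b. b \<in> box m \<Longrightarrow> f b ! i = b ! j) \<Longrightarrow> coord m n f j = i"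
proof -
  obtain c d where inj: "inj_on c {..<m}" and c: "c ` {..<m} \<subseteq> {..<n}"
    and f': "\<forall>b\<in>box m. (\<forall>j<m. f b ! c j = b ! j) \<and> (\<forall>i<n. i \<notin> c ` {..<m} \<longrightarrow> f b ! i = d i)"
    using cube_map_coordinates[OF f] by (elim exE conjE) (rule that)
  have f1: "f b ! c j = b ! j" if "b \<in> box m" "j < m" for b j
    using that f' by simp
  have f2: "f b ! i = d i" if "b \<in> box m" "i < n" "i \<notin> c ` {..<m}" for b i
    using that f' by simp
  \<comment> \<open>A position carrying another input is detected by the vertex whose only
    \<open>True\<close> is at \<open>j\<close>; a constant position by the vertex with all entries
    opposite to that constant.\<close>
  have other: "\<exists>b\<in>box m. f b ! k \<noteq> b ! j" if k: "k < n" "k \<noteq> c j" for k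
  proof (cases "k \<in> c ` {..<m}")
    case True
    then obtain l where l: "l < m" "k = c l" by blast
    let ?b = "(replicate m False)[j := True]"
    have b: "?b \<in> box m" by (simp add: box_def)
    have "f ?b ! k = ?b ! l" using f1[OF b l(1)] l(2) by simp
    moreover have "l \<noteq> j" using l k(2) by auto
    ultimately have "f ?b ! k \<noteq> ?b ! j" using l(1) j by simp
    with b show ?thesis by blast
  next
    case False
    have b: "replicate m (\<not> d k) \<in> box m" by (simp add: box_def)
    have "f (replicate m (\<not> d k)) ! k \<noteq> replicate m (\<not> d k) ! j"
      using f2[OF b k(1) False] j by simp
    with b show ?thesis by blast
  qed
  have *: "coord m n f j = c j"
  proof (rule coord_eqI)
    show "c j < n" using c j by blast
    show "f b ! c j = b ! j" if "b \<in> box m" for b using f1[OF that j] .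
  qed (rule other)
  show "coord m n f j < n" using * c j by auto
  show "f b ! coord m n f j = b ! j" if "b \<in> box m"
    using * f1[OF that j] by simp
  show "coord m n f j = i" if "i < n" "\<And>b. b \<in> box m \<Longrightarrow> f b ! i = b ! j"
    using * other[OF that(1)] that(2) by metis
qed

lemma coord_compose:
  assumes f: "cube_map m n f" and g: "cube_map n p g" and j: "j < m"
  shows "coord m p (compose (box m) g f) j = coord n p g (coord m n f j)"
proof (rule coord_unique[OF cube_map.comp[OF f g] j])
  note k = coord_less[OF f j]
  show "coord n p g (coord m n f j) < p" using coord_less[OF g k] .
  show "compose (box m) g f b ! coord n p g (coord m n f j) = b ! j" if "b \<in> box m" for b
    using that by (simp add: compose_eq nth_coord[OF g k] nth_coord[OF f j] cube_map_in_box[OF f])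
qed

section \<open>Functoriality of the action on words\<close>

lemma length_word_act [simp]: "length (word_act m n f xs) = m"
  by (simp add: word_act_def)

lemma word_act_ident:
  assumes "length xs = n"
  shows "word_act n n (restrict (\<lambda>b. b) (box n)) xs = xs"
proof (rule nth_equalityI)
  fix j assume "j < length (word_act n n (restrict (\<lambda>b. b) (box n)) xs)"
  then have j: "j < n" by simp
  have "coord n n (restrict (\<lambda>b. b) (box n)) j = j"
    by (rule coord_unique[OF cube_map.ident j j]) simp
  then show "word_act n n (restrict (\<lambda>b. b) (box n)) xs ! j = xs ! j"
    using j by (simp add: word_act_def)
qed (simp add: assms)

lemma word_act_compose:
  assumes "cube_map m n f" and "cube_map n p g"
  shows "word_act m p (compose (box m) g f) xs = word_act m n f (word_act n p g xs)"
  by (simp add: word_act_def coord_compose[OF assms] coord_less[OF assms(1)])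

lemma word_act_in_lists:
  assumes "cube_map m n f" and "xs \<in> lists A" and "length xs = n"
  shows "word_act m n f xs \<in> lists A"
  using assms(2,3) coord_less[OF assms(1)] by (auto simp: word_act_def in_lists_conv_set)

text \<open>With one label throughout, labels cannot obstruct a map between labelled
  presheaves.\<close>

lemma word_act_replicate:
  assumes "cube_map m n f"
  shows "word_act m n f (replicate n x) = replicate m x"
  by (rule nth_equalityI) (simp_all add: word_act_def coord_less[OF assms])

section \<open>Smallness\<close>

lemma infinite_UNIV_elem: "infinite (UNIV :: 'u elem set)"
proof -
  have "inj (Num :: nat \<Rightarrow> 'u elem)"
    by (simp add: inj_on_def)
  then show ?thesis
    using range_inj_infinite infinite_super[OF subset_UNIV] by blast
qed

lemma small_finite: "finite A \<Longrightarrow> small A"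
  unfolding small_def by (rule finite_lesspoll_infinite) (simp_all add: infinite_UNIV_elem)

text \<open>Each further letter costs a factor \<open>A\<close>, absorbed by
  \<open>A \<times> A \<approx> A\<close>.\<close>

lemma lists_length_lepoll:
  assumes "infinite A"
  shows "{xs \<in> lists A. length xs = n} \<lesssim> A"
proof (induction n)
  case 0
  obtain a where "a \<in> A" using assms by fastforce
  moreover have "{xs \<in> lists A. length xs = 0} = {[]}" by auto
  ultimately show ?case by (auto intro!: subset_image_lepoll[where f = "\<lambda>_. []"])
next
  case (Suc n)
  have "{xs \<in> lists A. length xs = Suc n} =
      (\<lambda>(x, xs). x # xs) ` (A \<times> {xs \<in> lists A. length xs = n})"
    by (auto simp: image_iff length_Suc_conv)
  then have "{xs \<in> lists A. length xs = Suc n} \<lesssim> A \<times> {xs \<in> lists A. length xs = n}"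
    by (simp add: image_lepoll)
  also have "\<dots> \<lesssim> A \<times> A"
    using Suc by (simp add: times_lepoll_mono)
  also have "A \<times> A \<approx> A"
    using card_of_Times_same_infinite[OF assms] card_of_ordIso unfolding eqpoll_def by blast
  finally show ?case .
qed

lemma small_words:
  assumes "small A"
  shows "small (Tup ` {xs \<in> lists A. length xs = n})"
proof (cases "finite A")
  case True
  then show ?thesis
    using finite_lists_length_eq[of A n] by (intro small_finite) (simp add: lists_eq_set)
next
  case False
  show ?thesis
    using lesspoll_trans1[OF lepoll_trans[OF image_lepoll lists_length_lepoll[OF False]]] assms
    unfolding small_def by blast
qed

section \<open>Presheaves of words, cubes and boundaries\<close>

lemma is_psh_words:
  assumes "small A"
  shows "is_psh (words_psh A)"
proof -
  have "u \<in> A" if "cube_map m (length xs) f" "\<forall>v\<in>set xs. v \<in> A"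
    "u \<in> set (word_act m (length xs) f xs)" for m f u xs
    using word_act_in_lists[OF that(1), of xs A] that(2,3) by auto
  then show ?thesis
    using small_words[OF assms]
    by (auto simp: is_psh_def words_psh_def word_act_ident word_act_compose)
qed

lemma finite_box: "finite (box n)"
  using finite_lists_length_eq[of "UNIV :: bool set" n] by (simp add: box_def)

text \<open>The action is precomposition, so the presheaf laws are those of composition; smallness
  comes from the finite function space between boxes.\<close>

lemma is_psh_box: "is_psh (box_psh n)"
proof -
  have "finite {f. cube_map m n f}" for m
    by (rule finite_subset[OF _ finite_PiE[of "box m" "\<lambda>_. box n"]])
      (auto simp: finite_box dest: cube_map_PiE)
  then have "small (Cmap ` {f. cube_map m n f})" for m
    by (simp add: small_finite)
  then show ?thesis
    by (auto simp: is_psh_def box_psh_def cube_map.comp compose_assoc[OF cube_map_funcset]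
        compose_Id[OF cube_map_funcset cube_map_extensional])
qed

text \<open>A cube map into degree \<open>p < n\<close> starts in degree at most \<open>p\<close>,
  so the action never leaves the degrees below \<open>n\<close>.\<close>

lemma is_psh_boundary: "is_psh (boundary_psh n)"
proof -
  have "m < n" if "cube_map m p h" "p < n" for m p h
    using cube_map_dim_le[OF that(1)] that(2) by simp
  then show ?thesis
    using is_psh_box[of n] by (auto simp: is_psh_def boundary_psh_def small_finite Pi_iff)
qed

section \<open>Labelled subpresheaves of a cube\<close>

text \<open>Treats cube and boundary alike, so that one construction serves for maps from edge to
  boundary, boundary to square and edge to square.\<close>

definition subbox :: "nat \<Rightarrow> 'u psh \<Rightarrow> bool" where
  "subbox n P \<longleftrightarrow> is_psh P \<and> psh_act P = psh_act (box_psh n) \<and>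
     (\<forall>m. cells P m \<subseteq> cells (box_psh n) m)"

lemma subbox_box: "subbox n (box_psh n)"
  by (simp add: subbox_def is_psh_box)

lemma subbox_boundary: "subbox n (boundary_psh n)"
  using is_psh_boundary[of n] by (simp add: subbox_def boundary_psh_def)

lemma subbox_cell:
  assumes "subbox n P" "x \<in> cells P m"
  shows "cube_map m n (cmap x)" and "Cmap (cmap x) = x"
proof -
  have "x \<in> cells (box_psh n) m"
    using assms by (auto simp: subbox_def)
  then show "cube_map m n (cmap x)" and "Cmap (cmap x) = x"
    by (auto simp: box_psh_def)
qed

lemma psh_act_subbox:
  "subbox n P \<Longrightarrow> psh_act P m p f x = Cmap (compose (box m) (cmap x) f)"
  by (simp add: subbox_def box_psh_def)

lemma subbox_act_closed:
  "subbox n P \<Longrightarrow> cube_map m p f \<Longrightarrow> x \<in> cells P p \<Longrightarrow> psh_act P m p f x \<in> cells P m"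
  unfolding subbox_def is_psh_def by blast

definition lab_subbox :: "'u elem set \<Rightarrow> 'u elem list \<Rightarrow> 'u psh \<Rightarrow> 'u psh_map" where
  "lab_subbox Sg as P = mk_psh_map P (words_psh Sg)
     (\<lambda>m x. Tup (word_act m (length as) (cmap x) as))"

lemma lab_subbox_simps [simp]:
  "psh_dom (lab_subbox Sg as P) = P" "psh_cod (lab_subbox Sg as P) = words_psh Sg"
  by (simp_all add: lab_subbox_def mk_psh_map_def)

lemma PSH_Dom_Cod: "Dom PSH = psh_dom" "Cod PSH = psh_cod"
  by (simp_all add: PSH_def)

lemma lab_box_eq: "lab_box Sg as = lab_subbox Sg as (box_psh (length as))"
  by (simp add: lab_box_def lab_subbox_def)

text \<open>Cells are acted on by precomposition, so naturality of the labelling is functoriality of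
  \<open>word_act\<close>.\<close>

lemma lab_subbox_arr:
  assumes "small Sg" and as: "as \<in> lists Sg" and P: "subbox (length as) P"
  shows "lab_subbox Sg as P \<in> Arr PSH"
proof -
  have "word_act m (length as) (cmap x) as \<in> lists Sg" if "x \<in> cells P m" for m x
    using word_act_in_lists[OF subbox_cell(1)[OF P that] as] by simp
  then have cell: "Tup (word_act m (length as) (cmap x) as) \<in> cells (words_psh Sg) m"
    if "x \<in> cells P m" for m x
    using that by (simp add: words_psh_def)
  have act: "word_act m (length as) (cmap (psh_act P m n h x)) as =
      word_act m n h (word_act n (length as) (cmap x) as)"
    if h: "cube_map m n h" and x: "x \<in> cells P n" for m n h x
    using word_act_compose[OF h subbox_cell(1)[OF P x]] by (simp add: psh_act_subbox[OF P])
  have closed: "psh_act P m n h x \<in> cells P m" if "cube_map m n h" "x \<in> cells P n" for m n h x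
    using subbox_act_closed[OF P that] .
  have "is_psh P" using P by (simp add: subbox_def)
  moreover have "psh_act (words_psh Sg) m n h (Tup w) = Tup (word_act m n h w)" for m n h w
    by (simp add: words_psh_def)
  ultimately show ?thesis
    using is_psh_words[OF assms(1)] cell act closed
    by (simp add: PSH_def lab_subbox_def mk_psh_map_def)
qed

section \<open>Maps given by postcomposition\<close>

text \<open>Any function \<open>k\<close> on vertices is allowed, not just a morphism of cubes; this
  leaves room for the fold.\<close>

definition postcomp :: "(bool list \<Rightarrow> bool list) \<Rightarrow> nat \<Rightarrow> 'u elem \<Rightarrow> 'u elem" where
  "postcomp k m x = Cmap (compose (box m) k (cmap x))"

text \<open>Postcomposition commutes with precomposition by associativity, whatever \<open>k\<close>
  is, and both labellings give constant words in \<open>x\<close>. What remains to be asked of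
  \<open>k\<close> is that it carries cells to cells.\<close>

lemma lsp_hom_postcomp:
  assumes "small Sg" and "x \<in> Sg" and P: "subbox n P" and Q: "subbox p Q"
    and cell: "\<And>m c. c \<in> cells P m \<Longrightarrow> postcomp k m c \<in> cells Q m"
  shows "mk_lsp_map (lab_subbox Sg (replicate n x) P) (lab_subbox Sg (replicate p x) Q) (postcomp k) \<in>
    hom_set (LSP Sg) (lab_subbox Sg (replicate n x) P) (lab_subbox Sg (replicate p x) Q)"
    (is "mk_lsp_map ?p ?q _ \<in> _")
proof -
  have arr: "?p \<in> Arr PSH" "?q \<in> Arr PSH"
    using assms by (auto intro!: lab_subbox_arr simp: in_lists_conv_set)
  have nat: "postcomp k m (psh_act P m l h c) = psh_act Q m l h (postcomp k l c)"
    if h: "cube_map m l h" for m l h c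
    by (simp add: postcomp_def psh_act_subbox[OF P] psh_act_subbox[OF Q]
        compose_assoc[OF cube_map_funcset[OF h]])
  have closed: "psh_act P m l h c \<in> cells P m" if "cube_map m l h" "c \<in> cells P l" for m l h c
    using subbox_act_closed[OF P that] .
  have "word_act m p (cmap (postcomp k m c)) (replicate p x) =
      word_act m n (cmap c) (replicate n x)" if "c \<in> cells P m" for m c
    using word_act_replicate[OF subbox_cell(1)[OF P that], of x]
      word_act_replicate[OF subbox_cell(1)[OF Q cell[OF that]], of x] by simp
  then have "Comp PSH ?q (mk_psh_map P Q (postcomp k)) = ?p"
    using cell by (simp add: PSH_def lab_subbox_def mk_psh_map_def fun_eq_iff restrict_def)
  moreover have "mk_psh_map P Q (postcomp k) \<in> hom_set PSH P Q"
    using P Q cell nat closed by (simp add: hom_set_def PSH_def mk_psh_map_def subbox_def)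
  ultimately show ?thesis
    using arr by (simp add: hom_set_def LSP_def slice_def mk_lsp_map_def PSH_Dom_Cod)
qed

lemma Comp_LSP_postcomp:
  assumes P: "subbox n (psh_dom p)"
    and cell: "\<And>m c. c \<in> cells (psh_dom p) m \<Longrightarrow> postcomp k m c \<in> cells (psh_dom q) m"
  shows "Comp (LSP Sg) (mk_lsp_map q r (postcomp l)) (mk_lsp_map p q (postcomp k)) =
    mk_lsp_map p r (postcomp (l \<circ> k))"
proof -
  have "postcomp l m (postcomp k m c) = postcomp (l \<circ> k) m c" for m and c :: "'a elem"
    by (simp add: postcomp_def compose_def restrict_def fun_eq_iff)
  then show ?thesis
    using cell by (simp add: LSP_def slice_def mk_lsp_map_def PSH_def mk_psh_map_def
        restrict_def fun_eq_iff)
qed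

section \<open>Vertices and edges of the square\<close>

lemma box_0 [simp]: "box 0 = {[]}"
  by (auto simp: box_def)

text \<open>The entries of \<open>e\<close> are inserted one by one at the front, each by a face
  map.\<close>

lemma cube_map_vertex: "cube_map 0 (length e) (restrict (\<lambda>b. e) (box 0))"
proof (induction e)
  case Nil
  have "restrict (\<lambda>b. []) (box 0) = restrict (\<lambda>b. b) (box 0)"
    by (auto simp: fun_eq_iff)
  then show ?case using cube_map.ident[of 0] by (metis list.size(3))
next
  case (Cons a e)
  have "compose (box 0) (restrict (\<lambda>b. take 0 b @ a # drop 0 b) (box (length e)))
      (restrict (\<lambda>b. e) (box 0)) = restrict (\<lambda>b. a # e) (box 0)"
    by (auto simp: fun_eq_iff compose_def box_def)
  then show ?case
    using cube_map.comp[OF Cons cube_map.face[of 0 "length e" a]] by (metis le0 length_Cons)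
qed

text \<open>Appending is the face at the last position; on the 1-cube it yields two parallel sides
  of the square.\<close>

lemma cube_map_snoc:
  assumes h: "cube_map m n h"
  shows "cube_map m (Suc n) (compose (box m) (\<lambda>b. b @ [\<alpha>]) h)"
proof -
  have "compose (box m) (restrict (\<lambda>b. take n b @ \<alpha> # drop n b) (box n)) h =
      compose (box m) (\<lambda>b. b @ [\<alpha>]) h"
    using cube_map_in_box[OF h] by (auto simp: fun_eq_iff compose_def box_def)
  then show ?thesis
    using cube_map.comp[OF h cube_map.face[of n n \<alpha>]] by simp
qed

text \<open>
  The values of this map on 00, 10, 01, 11 are 00, 10, 10, 11.  It is not a morphism of cubes, but
  it maps the boundary of the square into the square, turning the parallel edges 00--10 and
  01--11 into edges of different directions.
\<close>

definition fold_square :: "bool list \<Rightarrow> bool list" where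
  "fold_square b = [b ! 0 \<or> b ! 1, b ! 0 \<and> b ! 1]"

text \<open>On an edge one entry moves and the other is a constant \<open>e\<close>. Of their
  disjunction and conjunction, one is again \<open>e\<close> and the other is the moving entry, so
  the result is a face map. The bound on \<open>m\<close> matters: on the whole square the fold
  identifies two vertices.\<close>

lemma cube_map_fold_square:
  assumes h: "cube_map m 2 h" and m: "m < 2"
  shows "cube_map m 2 (compose (box m) fold_square h)"
proof (cases m)
  case 0
  have "compose (box 0) fold_square h = restrict (\<lambda>b. fold_square (h [])) (box 0)"
    by (auto simp: fun_eq_iff compose_def)
  then show ?thesis
    using cube_map_vertex[of "fold_square (h [])"] 0 by (simp add: fold_square_def numeral_2_eq_2)
next
  case (Suc l)
  then have m1: "m = 1" using m by simp
  obtain c :: "nat \<Rightarrow> nat" and d where c: "c ` {..<m} \<subseteq> {..<2}"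
    and h': "\<forall>b\<in>box m. (\<forall>j<m. h b ! c j = b ! j) \<and> (\<forall>i<2. i \<notin> c ` {..<m} \<longrightarrow> h b ! i = d i)"
    using cube_map_coordinates[OF h] by (elim exE conjE) (rule that)
  \<comment> \<open>The fold is symmetric in its two entries, so both directions of the edge give
    the same form.\<close>
  obtain e where e: "\<forall>b\<in>box m. fold_square (h b) = [b ! 0 \<or> e, b ! 0 \<and> e]"
  proof (cases "c 0 = 0")
    case True
    then have "\<forall>b\<in>box m. h b ! 0 = b ! 0 \<and> h b ! 1 = d 1"
      using h' m1 by auto
    then show ?thesis by (intro that[of "d 1"]) (simp add: fold_square_def)
  next
    case False
    then have "c 0 = 1" using c m1 by auto
    then have "\<forall>b\<in>box m. h b ! 1 = b ! 0 \<and> h b ! 0 = d 0"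
      using h' m1 by auto
    then show ?thesis by (intro that[of "d 0"]) (auto simp: fold_square_def)
  qed
  have "compose (box m) fold_square h =
      restrict (\<lambda>b. take (if e then 0 else 1) b @ e # drop (if e then 0 else 1) b) (box 1)"
    using e m1 by (auto simp: fun_eq_iff compose_def box_def length_Suc_conv)
  then show ?thesis
    using cube_map.face[of "if e then 0 else 1" 1 e] m1 by (simp add: numeral_2_eq_2)
qed

section \<open>Actions of realized edges\<close>

lemma actions_cube: "actions (cube as) = (\<lambda>i. copy i (as ! i)) ` {..<length as}"
  by (simp add: cube_def Let_def)

text \<open>
  A realized edge of a labelled cube is only known on states; its action is read off from the
  coordinate that changes between its two ends.
\<close>

lemma realization_edge_action:
  assumes T: "is_realization Sg T" and x: "x \<in> Sg" and bs: "bs \<in> lists Sg"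
    and F: "F \<in> hom_set (LSP Sg) (lab_box Sg [x]) (lab_box Sg bs)"
    and i: "i < length bs"
      "cmap (on_cells (sl_arr F) 0 (vertex [False])) [] ! i \<noteq>
       cmap (on_cells (sl_arr F) 0 (vertex [True])) [] ! i"
  shows "on_actions (farr T F) (copy 0 x) = copy i (bs ! i)"
proof -
  let ?u = "\<lambda>e. cmap (on_cells (sl_arr F) 0 (vertex e)) []"
  have fT: "is_functor (LSP Sg) (CTS Sg) T"
    and objT: "fobj T (lab_box Sg as) = cube as" if "as \<in> lists Sg" for as
    using T that unfolding is_realization_def by blast+
  have xs: "[x] \<in> lists Sg" using x by simp
  have F': "F \<in> Arr (LSP Sg)" "Dom (LSP Sg) F = lab_box Sg [x]" "Cod (LSP Sg) F = lab_box Sg bs"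
    using F by (auto simp: hom_set_def)
  have "farr T F \<in> hom_set (CTS Sg) (cube [x]) (cube bs)"
    using fT[OF xs] F' objT[OF xs] objT[OF bs] unfolding is_functor_def by metis
  then have arr: "farr T F \<in> Arr (WHDTS Sg)" "ts_dom (farr T F) = cube [x]"
      "ts_cod (farr T F) = cube bs"
    by (auto simp: hom_set_def CTS_def full_subcategory_def WHDTS_def)
  have st: "on_states (farr T F) (Bits e) = Bits (?u e)" if "e \<in> box 1" for e
    using T xs bs F that unfolding is_realization_def by fastforce
  have "(Bits [False], [copy 0 x], Bits [True]) \<in> trans (cube [x])"
    by (auto simp: cube_def Let_def intro!: exI[of _ "[0]"])
  then have "(on_states (farr T F) (Bits [False]), [on_actions (farr T F) (copy 0 x)],
      on_states (farr T F) (Bits [True])) \<in> trans (cube bs)"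
    using arr by (force simp: WHDTS_def)
  then have "(Bits (?u [False]), [on_actions (farr T F) (copy 0 x)], Bits (?u [True])) \<in>
      trans (cube bs)"
    by (simp add: st box_def)
  \<comment> \<open>A transition with one action has a one-element index list, and its ends differ
    exactly at that index; hence the index is \<open>i\<close>.\<close>
  then show ?thesis
    using i by (auto simp: cube_def Let_def)
qed

section \<open>Inclusion and fold of the boundary of the square\<close>

theorem proposition7p5:
  fixes Sg :: "'u elem set"
    and T :: "('u psh_map, 'u psh_map slice_arr, 'u whdts, 'u ts_map) fctr"
    and M :: "'u psh_map slice_arr model"
    and N :: "'u ts_map model"
  assumes "Sg \<noteq> {}"
    and "small Sg"
    and "is_lsp_model Sg M"
    and "is_cts_model Sg N"
    and "is_realization Sg T"
  shows "\<not> left_quillen (LSP Sg) M (CTS Sg) N T"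
proof
  assume Q: "left_quillen (LSP Sg) M (CTS Sg) N T"
  obtain x where x: "x \<in> Sg" using assms(1) by blast
  define X where "X = lab_subbox Sg (replicate 1 x) (box_psh 1)"
  define B where "B = lab_subbox Sg (replicate 2 x) (boundary_psh 2)"
  define Y where "Y = lab_subbox Sg (replicate 2 x) (box_psh 2)"
  have X: "X = lab_box Sg [x]" and Y: "Y = lab_box Sg [x, x]"
    by (simp_all add: X_def Y_def lab_box_eq numeral_2_eq_2)
  \<comment> \<open>\<open>E False\<close> and \<open>E True\<close> are the parallel sides 00--10
    and 01--11.\<close>
  define E where "E \<alpha> = mk_lsp_map X B (postcomp (\<lambda>b. b @ [\<alpha>]))" for \<alpha>
  \<comment> \<open>The identity gives the inclusion of the boundary, \<open>fold_square\<close> the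
    folding map.\<close>
  define G where "G k = mk_lsp_map B Y (postcomp k)" for k
  \<comment> \<open>Cells of the edge have degree at most 1, so their images stay in the
    boundary.\<close>
  have E_cell: "postcomp (\<lambda>b. b @ [\<alpha>]) m c \<in> cells (boundary_psh 2) m"
    if "c \<in> cells (box_psh 1 :: 'u psh) m" for \<alpha> m and c :: "'u elem"
    using cube_map_snoc[OF subbox_cell(1)[OF subbox_box that], of \<alpha>]
      cube_map_dim_le[OF subbox_cell(1)[OF subbox_box that]]
    by (simp add: postcomp_def boundary_psh_def box_psh_def numeral_2_eq_2)
  have G_cell: "postcomp k m c \<in> cells (box_psh 2) m"
    if "k = (\<lambda>b. b) \<or> k = fold_square" "c \<in> cells (boundary_psh 2 :: 'u psh) m"
    for k m and c :: "'u elem"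
  proof -
    have h: "cube_map m 2 (cmap c)" by (rule subbox_cell(1)[OF subbox_boundary that(2)])
    have "m < 2" using that(2) by (auto simp: boundary_psh_def split: if_splits)
    then have "cube_map m 2 (compose (box m) k (cmap c))"
      using that(1) h cube_map_fold_square[OF h] by (auto simp: cube_map_compose_id[OF h])
    then show ?thesis by (simp add: postcomp_def box_psh_def)
  qed
  have E: "E \<alpha> \<in> hom_set (LSP Sg) X B" for \<alpha>
    unfolding E_def X_def B_def
    by (rule lsp_hom_postcomp[OF assms(2) x subbox_box subbox_boundary E_cell])
  have G: "G k \<in> hom_set (LSP Sg) B Y" if "k = (\<lambda>b. b) \<or> k = fold_square" for k
    unfolding G_def Y_def B_def
    by (rule lsp_hom_postcomp[OF assms(2) x subbox_boundary subbox_box G_cell[OF that]])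
  have GE: "Comp (LSP Sg) (G k) (E \<alpha>) = mk_lsp_map X Y (postcomp (k \<circ> (\<lambda>b. b @ [\<alpha>])))" for k \<alpha>
    unfolding G_def E_def
    by (rule Comp_LSP_postcomp[of 1]) (simp_all add: X_def B_def subbox_box E_cell)
  \<comment> \<open>\<open>is_realization\<close> prescribes states for maps between labelled cubes,
    so maps out of \<open>B\<close> are studied through their composites from edge to
    square.\<close>
  have GE_hom: "Comp (LSP Sg) (G k) (E \<alpha>) \<in> hom_set (LSP Sg) X Y"
    if k: "k = (\<lambda>b. b) \<or> k = fold_square" for k \<alpha>
    unfolding GE X_def Y_def
  proof (rule lsp_hom_postcomp[OF assms(2) x subbox_box subbox_box])
    fix m and c :: "'u elem" assume c: "c \<in> cells (box_psh 1) m"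
    have "postcomp (k \<circ> (\<lambda>b. b @ [\<alpha>])) m c = postcomp k m (postcomp (\<lambda>b. b @ [\<alpha>]) m c)"
      by (simp add: postcomp_def compose_def restrict_def fun_eq_iff)
    then show "postcomp (k \<circ> (\<lambda>b. b @ [\<alpha>])) m c \<in> cells (box_psh 2) m"
      using G_cell[OF k E_cell[OF c]] by simp
  qed
  have fT: "is_functor (LSP Sg) (CTS Sg) T"
    using assms(5) by (simp add: is_realization_def)
  have TE: "farr T (E \<alpha>) \<in> hom_set (CTS Sg) (cube [x]) (fobj T B)" for \<alpha>
  proof -
    have "fobj T X = cube [x]" using assms(5) x by (simp add: is_realization_def X)
    then show ?thesis using fT E[of \<alpha>] by (auto simp: is_functor_def hom_set_def)
  qed
  have TG: "farr T (G k) \<in> hom_set (CTS Sg) (fobj T B) (fobj T Y)"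
    if "k = (\<lambda>b. b) \<or> k = fold_square" for k
    using fT G[OF that] by (auto simp: is_functor_def hom_set_def)
  have a0: "copy 0 x \<in> actions (cube [x])" by (simp add: actions_cube)
  \<comment> \<open>The actions of the two parallel sides in the realization of
    \<open>B\<close>.\<close>
  define a where "a \<alpha> = on_actions (farr T (E \<alpha>)) (copy 0 x)" for \<alpha>
  have a: "a \<alpha> \<in> actions (fobj T B)" for \<alpha>
    using TE[of \<alpha>] a0
    by (auto simp: a_def hom_set_def CTS_def full_subcategory_def WHDTS_def)
  \<comment> \<open>Here \<open>i\<close> is a coordinate that varies along the image of the side
    under \<open>k\<close>.\<close>
  have Ga: "on_actions (farr T (G k)) (a \<alpha>) = copy i x"
    if k: "k = (\<lambda>b. b) \<or> k = fold_square" and i: "i < 2" "k [False, \<alpha>] ! i \<noteq> k [True, \<alpha>] ! i"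
    for k \<alpha> i
  proof -
    have "farr T (Comp (LSP Sg) (G k) (E \<alpha>)) = Comp (CTS Sg) (farr T (G k)) (farr T (E \<alpha>))"
      using fT G[OF k] E[of \<alpha>] by (simp add: is_functor_def hom_set_def)
    then have "on_actions (farr T (G k)) (a \<alpha>) =
        on_actions (farr T (Comp (LSP Sg) (G k) (E \<alpha>))) (copy 0 x)"
      using TE[of \<alpha>] a0
      by (simp add: a_def CTS_def full_subcategory_def WHDTS_def mk_ts_map_def hom_set_def)
    also have "\<dots> = copy i ([x, x] ! i)"
    proof (rule realization_edge_action[OF assms(5) x])
      have "cmap (on_cells (sl_arr (Comp (LSP Sg) (G k) (E \<alpha>))) 0 (vertex [b])) [] = k [b, \<alpha>]" for b
        using cube_map_vertex[of "[b]"]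
        by (simp add: GE mk_lsp_map_def mk_psh_map_def X_def box_psh_def vertex_def postcomp_def
            compose_def)
      then show "cmap (on_cells (sl_arr (Comp (LSP Sg) (G k) (E \<alpha>))) 0 (vertex [False])) [] ! i \<noteq>
          cmap (on_cells (sl_arr (Comp (LSP Sg) (G k) (E \<alpha>))) 0 (vertex [True])) [] ! i"
        using i(2) by simp
    qed (use x i GE_hom[OF k] X Y in auto)
    also have "[x, x] ! i = x" using i(1) by (auto simp: less_2_cases_iff)
    finally show ?thesis .
  qed
  \<comment> \<open>Cells are extensional functions, so composing with the identity returns them
    unchanged; the inclusion is thus injective in every degree.\<close>
  have "postcomp (\<lambda>b. b) m c = c" if "c \<in> cells (boundary_psh 2 :: 'u psh) m" for m and c :: "'u elem"
    using cube_map_compose_id[OF subbox_cell(1)[OF subbox_boundary that]]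
      subbox_cell(2)[OF subbox_boundary that]
    by (simp add: postcomp_def)
  then have "G (\<lambda>b. b) \<in> lsp_cofibrations Sg"
    using G[of "\<lambda>b. b"]
    by (auto simp: lsp_cofibrations_def hom_set_def G_def mk_lsp_map_def mk_psh_map_def B_def
        intro!: inj_onI)
  then have "farr T (G (\<lambda>b. b)) \<in> cts_cofibrations Sg"
    using Q assms(3,4) by (auto simp: left_quillen_def is_lsp_model_def is_cts_model_def)
  then have "inj_on (on_actions (farr T (G (\<lambda>b. b)))) (actions (fobj T B))"
    using TG[of "\<lambda>b. b"]
    by (auto simp: cts_cofibrations_def hom_set_def CTS_def full_subcategory_def WHDTS_def)
  \<comment> \<open>In the square both sides vary in coordinate 0.\<close>
  moreover have "on_actions (farr T (G (\<lambda>b. b))) (a False) = on_actions (farr T (G (\<lambda>b. b))) (a True)"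
    using Ga[of "\<lambda>b. b" 0] by simp
  ultimately have "a False = a True"
    using a by (auto dest: inj_onD)
  \<comment> \<open>The fold keeps 00--10, which varies in coordinate 0, and sends 01--11 to 10--11,
    which varies in coordinate 1.\<close>
  then have "copy 0 x = copy 1 x"
    using Ga[of fold_square 0 False] Ga[of fold_square 1 True] by (simp add: fold_square_def)
  then show False by (simp add: copy_def)
qed

end
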